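(* Let $N\ge1$, let $m\in\mathbb R^N$, let $P\in\mathbb R^{N\times N}$ be a covariance matrix (symmetric positive semidefinite), let $R_0=\sigma_0^2>0$ and $R_i=2b_i^2$ with $b_i>0$ for $i=1,\dots,N$. Let $L\sim\mathcal N(m,P)$ and $$Z_0=\sum_{i=1}^NL_i+W_0,\qquad Z_i=L_i+W_i\quad(i=1,\dots,N),$$ where $W_0\sim\mathcal N(0,R_0)$, $W_i\sim\mathrm{Lap}(b_i)$, and $L,W_0,W_1,\dots,W_N$ are independent. Put $m_0:=\sum_i m_i$, $P_0:=\mathbf 1^TP\mathbf 1$, and $P_j:=\sum_{k=1}^NP_{jk}$. Then for each $j\in\{1,\dots,N\}$ the linear minimum mean square error (LMMSE) estimate of $L_j$ given the measurements $Z_0,Z_j$ is $$\hat L_j^{0,j}=\hat L_j^0+K_j\left[(Z_j-m_j)-\frac{P_j}{R_0+P_0}(Z_0-m_0)\right],$$ where $$\hat L_j^0=\mathbf E[L_j|Z_0]=m_j+\frac{P_j}{P_0+R_0}(Z_0-m_0)$$ and $$K_j=\frac{(R_0+P_0)P_{jj}-P_j^2}{(R_0+P_0)(P_{jj}+R_j)-P_j^2}\in[0,1].$$ The accuracy of $\hat L_j^{0,j}$ is $$Q_j^{0,j}:=\mathbf E[(L_j-\hat L_j^{0,j})^2]=Q_j^0(1-K_j)\le Q_j^0,$$ where $$Q_j^0=\mathbf E[(\hat L_j^0-L_j)^2]=P_{jj}-\frac{P_j^2}{P_0+R_0}.$$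
   Context: $\mathbf 1\in\mathbb R^N$ is the column vector of ones. $\mathrm{Lap}(b)$ is the zero-mean Laplace distribution with density $\frac{1}{2b}e^{-|w|/b}$, which has variance $2b^2$. The LMMSE estimate of a square-integrable random variable $X$ given a square-integrable random vector $Y$ is the estimator of the form $a+c^TY$ (with $a$ a constant and $c$ a constant vector) that minimizes the mean square error $\mathbf E[(X-a-c^TY)^2]$. $\hat L_j^0$ is the minimum mean square error estimate of $L_j$ when only $Z_0$ is available, and $Q_j^0$ is its mean square error. *)

theory Defs
  imports "HOL-Probability.Probability"
begin

(* Parametrised by the variance v; for v = 0 it is the point mass at mu. *)
definition normal_rv :: "'a measure \<Rightarrow> ('a \<Rightarrow> real) \<Rightarrow> real \<Rightarrow> real \<Rightarrow> bool" where
  "normal_rv M X \<mu> v \<longleftrightarrow>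
     X \<in> borel_measurable M \<and>
     (if v = 0 then distr M borel X = return borel \<mu>
      else v > 0 \<and> distributed M lborel X (\<lambda>x. ennreal (normal_density \<mu> (sqrt v) x)))"

(* Since P may be singular, N(m, P) need not have a density; hence the
   definition via linear functionals. *)
definition gaussian_vector ::
    "'a measure \<Rightarrow> ('a \<Rightarrow> real ^ 'n) \<Rightarrow> real ^ 'n \<Rightarrow> real ^ 'n ^ 'n \<Rightarrow> bool" where
  "gaussian_vector M X m P \<longleftrightarrow>
     X \<in> borel_measurable M \<and>
     (\<forall>u. normal_rv M (\<lambda>\<omega>. u \<bullet> X \<omega>) (u \<bullet> m) (u \<bullet> (P *v u)))"

definition covariance_matrix :: "real ^ 'n ^ 'n \<Rightarrow> bool" where
  "covariance_matrix P \<longleftrightarrow> transpose P = P \<and> (\<forall>u. 0 \<le> u \<bullet> (P *v u))"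

definition laplace_density :: "real \<Rightarrow> real \<Rightarrow> real" where
  "laplace_density b w = 1 / (2 * b) * exp (- \<bar>w\<bar> / b)"

definition laplace_rv :: "'a measure \<Rightarrow> ('a \<Rightarrow> real) \<Rightarrow> real \<Rightarrow> bool" where
  "laplace_rv M X b \<longleftrightarrow> distributed M lborel X (\<lambda>w. ennreal (laplace_density b w))"

definition generated_algebra ::
    "'a measure \<Rightarrow> ('a \<Rightarrow> 'b::topological_space) \<Rightarrow> 'a measure" where
  "generated_algebra M X = vimage_algebra (space M) X borel"

(* Mutual independence of the vector L and the scalars W0, W i.  The variables
   have different codomains, so indep_vars does not apply directly; as in its
   definition, independence means independence of the generated sigma-algebras. *)
datatype 'n source = Signal | Noise0 | Noise 'n

definition mutually_indep ::
    "'a measure \<Rightarrow> ('a \<Rightarrow> real ^ 'n) \<Rightarrow> ('a \<Rightarrow> real) \<Rightarrow> ('n \<Rightarrow> 'a \<Rightarrow> real) \<Rightarrow> bool" where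
  "mutually_indep M L W0 W \<longleftrightarrow>
     prob_space.indep_sets M
       (\<lambda>s. case s of
              Signal \<Rightarrow> sets (generated_algebra M L)
            | Noise0 \<Rightarrow> sets (generated_algebra M W0)
            | Noise i \<Rightarrow> sets (generated_algebra M (W i)))
       UNIV"

definition square_integrable :: "'a measure \<Rightarrow> ('a \<Rightarrow> 'b::euclidean_space) \<Rightarrow> bool" where
  "square_integrable M X \<longleftrightarrow> X \<in> borel_measurable M \<and> integrable M (\<lambda>\<omega>. (norm (X \<omega>))\<^sup>2)"

definition mse :: "'a measure \<Rightarrow> ('a \<Rightarrow> real) \<Rightarrow> ('a \<Rightarrow> real) \<Rightarrow> real" where
  "mse M X V = prob_space.expectation M (\<lambda>\<omega>. (X \<omega> - V \<omega>)\<^sup>2)"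

definition is_lmmse_estimate ::
    "'a measure \<Rightarrow> ('a \<Rightarrow> real) \<Rightarrow> ('a \<Rightarrow> 'b::euclidean_space) \<Rightarrow> ('a \<Rightarrow> real) \<Rightarrow> bool" where
  "is_lmmse_estimate M X Y V \<longleftrightarrow>
     square_integrable M X \<and> square_integrable M Y \<and>
     (\<exists>a c. V = (\<lambda>\<omega>. a + c \<bullet> Y \<omega>)) \<and>
     (\<forall>a c. mse M X V \<le> mse M X (\<lambda>\<omega>. a + c \<bullet> Y \<omega>))"

(* The competitors are restricted to square-integrable ones because the Bochner
   integral of a non-integrable function is 0; the others have infinite error. *)
definition is_mmse_estimate ::
    "'a measure \<Rightarrow> ('a \<Rightarrow> real) \<Rightarrow> ('a \<Rightarrow> 'b::euclidean_space) \<Rightarrow> ('a \<Rightarrow> real) \<Rightarrow> bool" where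
  "is_mmse_estimate M X Y V \<longleftrightarrow>
     square_integrable M X \<and> Y \<in> borel_measurable M \<and> square_integrable M V \<and>
     (\<exists>g \<in> borel_measurable borel. V = (\<lambda>\<omega>. g (Y \<omega>))) \<and>
     (\<forall>h \<in> borel_measurable borel. square_integrable M (\<lambda>\<omega>. h (Y \<omega>)) \<longrightarrow>
        mse M X V \<le> mse M X (\<lambda>\<omega>. h (Y \<omega>)))"

end

theory Submission
  imports Defs
begin

text \<open>Write $e_0$ for the error of the estimate of $L_j$ from the sum measurement $Z_0$. The affine form of
that estimate is chosen so that $e_0$ is uncorrelated with $Z_0$, and $Q_j^0$ is the variance of
$e_0$. Everything else follows from three observations.

First, $e_0$ and $Z_0$ are affine functions of the independent Gaussian sources $L$ and $W_0$, so every linear combination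
of them is Gaussian; as they are uncorrelated, the joint characteristic function of $(Z_0, e_0)$
factors. This implies $E[e_0 \mid Z_0] = 0$ (lemma \<open>cond_exp_zero_of_factoring_char\<close>), so the affine
estimate is the conditional expectation. The implication is proved without multivariate uniqueness
theorems: differentiating the factored characteristic function in the direction of $e_0$ gives
$E[e_0 \, e^{itZ_0}] = 0$ for all $t$, that is, the law of $Z_0$ weighted with the positive part of
$e_0$ and the law weighted with the negative part have the same Fourier transform; by the
one-dimensional uniqueness theorem of Levy they coincide.

Second, the new information in $Z_j$ is the innovation
$(Z_j - m_j) - \frac{P_j}{R_0 + P_0}(Z_0 - m_0) = e_0 + W_j$, where $W_j$ is uncorrelated with $e_0$ and
$Z_0$. The estimation problem is thus reduced to recovering $e_0$, of variance $q = Q_j^0$, from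
$e_0 + W_j$: the gain is $K_j = q / (q + R_j)$, which lies in $[0,1]$ because $q \<ge> 0$; the error is
$e_1 = (1 - K_j) e_0 - K_j W_j$ with mean square
$(1-K_j)^2 q + K_j^2 R_j = q (1 - K_j)$.

Third, both optimality claims, and the almost sure uniqueness of the optimal estimates, are the theorem of
Pythagoras in $L^2$ (lemma \<open>orthogonal_error_best\<close>): $e_0$ is orthogonal to all square-integrable
functions of $Z_0$ since $E[e_0 \mid Z_0] = 0$, and $e_1$ is orthogonal to constants, to $Z_0$ and to
the innovation, hence to all affine functions of $(Z_0, Z_j)$.\<close>

section \<open>Square-integrable random variables\<close>

lemma square_integrable_real:
  fixes X :: "'a \<Rightarrow> real"
  shows "square_integrable M X \<longleftrightarrow> X \<in> borel_measurable M \<and> integrable M (\<lambda>\<omega>. (X \<omega>)\<^sup>2)"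
  by (simp add: square_integrable_def)

text \<open>Square-integrability suffices for covariances to exist; the bound
$|xy| \<le> x^2 + y^2$ avoids the Cauchy-Schwarz inequality for integrals.\<close>

lemma square_integrable_mult:
  fixes X Y :: "'a \<Rightarrow> real"
  assumes X: "square_integrable M X" and Y: "square_integrable M Y"
  shows "integrable M (\<lambda>\<omega>. X \<omega> * Y \<omega>)"
proof (rule Bochner_Integration.integrable_bound)
  have [measurable]: "X \<in> borel_measurable M" "Y \<in> borel_measurable M"
    using X Y by (simp_all add: square_integrable_real)
  show "integrable M (\<lambda>\<omega>. (X \<omega>)\<^sup>2 + (Y \<omega>)\<^sup>2)"
    using X Y by (simp add: square_integrable_real)
  show "(\<lambda>\<omega>. X \<omega> * Y \<omega>) \<in> borel_measurable M" by measurable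
  have "\<bar>x * y\<bar> \<le> x\<^sup>2 + y\<^sup>2" for x y :: real
    using sum_squares_bound[of "\<bar>x\<bar>" "\<bar>y\<bar>"] abs_ge_zero[of "x * y"]
    unfolding abs_mult power2_abs by linarith
  then show "AE \<omega> in M. norm (X \<omega> * Y \<omega>) \<le> norm ((X \<omega>)\<^sup>2 + (Y \<omega>)\<^sup>2)"
    by simp
qed

lemma square_integrable_scale:
  fixes X :: "'a \<Rightarrow> real"
  assumes X: "square_integrable M X"
  shows "square_integrable M (\<lambda>\<omega>. c * X \<omega>)"
proof -
  have [measurable]: "X \<in> borel_measurable M" using X by (simp add: square_integrable_real)
  show ?thesis using X by (simp add: square_integrable_real power_mult_distrib)
qed

lemma square_integrable_add:
  fixes X Y :: "'a \<Rightarrow> real"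
  assumes X: "square_integrable M X" and Y: "square_integrable M Y"
  shows "square_integrable M (\<lambda>\<omega>. X \<omega> + Y \<omega>)"
proof -
  have [measurable]: "X \<in> borel_measurable M" "Y \<in> borel_measurable M"
    using X Y by (simp_all add: square_integrable_real)
  show ?thesis
    using X Y square_integrable_mult[OF X Y]
    by (simp add: square_integrable_real power2_sum mult.assoc)
qed

lemma square_integrable_diff:
  fixes X Y :: "'a \<Rightarrow> real"
  assumes X: "square_integrable M X" and Y: "square_integrable M Y"
  shows "square_integrable M (\<lambda>\<omega>. X \<omega> - Y \<omega>)"
  using square_integrable_add[OF X square_integrable_scale[OF Y, of "-1"]] by simp

lemma square_integrable_Pair:
  fixes X Y :: "'a \<Rightarrow> real"
  assumes X: "square_integrable M X" and Y: "square_integrable M Y"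
  shows "square_integrable M (\<lambda>\<omega>. (X \<omega>, Y \<omega>))"
proof -
  have [measurable]: "X \<in> borel_measurable M" "Y \<in> borel_measurable M"
    using X Y by (simp_all add: square_integrable_real)
  have "(\<lambda>\<omega>. (X \<omega>, Y \<omega>)) \<in> borel_measurable M" by (rule borel_measurable_Pair) measurable
  then show ?thesis using X Y by (simp add: square_integrable_def norm_Pair)
qed

context prob_space
begin

lemma square_integrable_const: "square_integrable M (\<lambda>\<omega>. c :: real)"
  by (simp add: square_integrable_real)

lemma square_integrable_integrable:
  fixes X :: "'a \<Rightarrow> real"
  shows "square_integrable M X \<Longrightarrow> integrable M X"
  using square_integrable_mult[OF _ square_integrable_const[of 1], of X] by simp

text \<open>The theorem of Pythagoras: if the error $X - V$ is orthogonal to the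
change $V - U$ of the estimate, then that change adds its full mean square to the error.\<close>

lemma mse_orthogonal_error:
  assumes X: "square_integrable M X" and V: "square_integrable M V" and U: "square_integrable M U"
    and orth: "expectation (\<lambda>\<omega>. (X \<omega> - V \<omega>) * (V \<omega> - U \<omega>)) = 0"
  shows "mse M X U = mse M X V + expectation (\<lambda>\<omega>. (V \<omega> - U \<omega>)\<^sup>2)"
proof -
  note XV = square_integrable_diff[OF X V] and VU = square_integrable_diff[OF V U]
  have "mse M X U = expectation (\<lambda>\<omega>. (X \<omega> - V \<omega>)\<^sup>2
      + (2 * ((X \<omega> - V \<omega>) * (V \<omega> - U \<omega>)) + (V \<omega> - U \<omega>)\<^sup>2))"
    unfolding mse_def
    by (rule Bochner_Integration.integral_cong) (auto simp: power2_eq_square algebra_simps)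
  also have "\<dots> = mse M X V + (2 * expectation (\<lambda>\<omega>. (X \<omega> - V \<omega>) * (V \<omega> - U \<omega>))
      + expectation (\<lambda>\<omega>. (V \<omega> - U \<omega>)\<^sup>2))"
    using XV VU square_integrable_mult[OF XV VU] by (simp add: mse_def square_integrable_real)
  finally show ?thesis using orth by simp
qed

text \<open>Orthogonality of the error is thus sufficient for optimality, and a competitor
that is equally good differs from the optimum by a random variable of mean square zero. The comparison is
with a single competitor, so that the lemma serves any class of competitors.\<close>

lemma orthogonal_error_best:
  assumes X: "square_integrable M X" and V: "square_integrable M V" and U: "square_integrable M U"
    and orth: "expectation (\<lambda>\<omega>. (X \<omega> - V \<omega>) * (V \<omega> - U \<omega>)) = 0"
  shows "mse M X V \<le> mse M X U"
    and "mse M X U \<le> mse M X V \<Longrightarrow> AE \<omega> in M. U \<omega> = V \<omega>"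
proof -
  note eq = mse_orthogonal_error[OF assms]
  have pos: "0 \<le> expectation (\<lambda>\<omega>. (V \<omega> - U \<omega>)\<^sup>2)" by simp
  from eq pos show "mse M X V \<le> mse M X U" by linarith
  assume "mse M X U \<le> mse M X V"
  with eq pos have "expectation (\<lambda>\<omega>. (V \<omega> - U \<omega>)\<^sup>2) = 0" by linarith
  moreover have "integrable M (\<lambda>\<omega>. (V \<omega> - U \<omega>)\<^sup>2)"
    using square_integrable_diff[OF V U] by (simp add: square_integrable_real)
  ultimately have "AE \<omega> in M. (V \<omega> - U \<omega>)\<^sup>2 = 0"
    by (simp add: integral_nonneg_eq_0_iff_AE)
  then show "AE \<omega> in M. U \<omega> = V \<omega>" by eventually_elim simp
qed

section \<open>Moments of normal and Laplace variables\<close>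

lemma normal_rv_degenerate:
  assumes "normal_rv M X \<mu> 0"
  shows "AE \<omega> in M. X \<omega> = \<mu>"
proof -
  have [measurable]: "X \<in> borel_measurable M" and D: "distr M borel X = return borel \<mu>"
    using assms by (auto simp: normal_rv_def)
  have "AE x in distr M borel X. x = \<mu>" unfolding D by (simp add: AE_return)
  then show ?thesis by (simp add: AE_distr_iff)
qed

lemma normal_rv_moments:
  assumes N: "normal_rv M X \<mu> v"
  shows "square_integrable M X" and "expectation X = \<mu>"
    and "expectation (\<lambda>\<omega>. (X \<omega> - \<mu>)\<^sup>2) = v"
proof -
  have [measurable]: "X \<in> borel_measurable M" using N by (simp add: normal_rv_def)
  have "square_integrable M X \<and> expectation X = \<mu> \<and> expectation (\<lambda>\<omega>. (X \<omega> - \<mu>)\<^sup>2) = v"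
  proof (cases "v = 0")
    case True
    have AE: "AE \<omega> in M. X \<omega> = \<mu>" using normal_rv_degenerate N True by simp
    have "integrable M (\<lambda>\<omega>. (X \<omega>)\<^sup>2)"
      by (subst integrable_cong_AE[where g="\<lambda>_. \<mu>\<^sup>2"]) (use AE in auto)
    moreover have "expectation X = expectation (\<lambda>_. \<mu>)"
      by (rule integral_cong_AE) (use AE in auto)
    moreover have "expectation (\<lambda>\<omega>. (X \<omega> - \<mu>)\<^sup>2) = expectation (\<lambda>_. 0)"
      by (rule integral_cong_AE) (use AE in auto)
    ultimately show ?thesis using True by (simp add: square_integrable_real prob_space)
  next
    case False
    then have v: "0 < v" and D: "distributed M lborel X (normal_density \<mu> (sqrt v))"
      using N by (auto simp: normal_rv_def)
    have "integrable M (\<lambda>\<omega>. (X \<omega> - \<mu>)\<^sup>2)"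
      using integrable_normal_moment[of "sqrt v" \<mu> 2] v
        distributed_integrable[OF D, of "\<lambda>x. (x - \<mu>)\<^sup>2"]
      by simp
    then have "square_integrable M (\<lambda>\<omega>. X \<omega> - \<mu>)" by (simp add: square_integrable_real)
    from square_integrable_add[OF this square_integrable_const[of \<mu>]]
    have "square_integrable M X" by simp
    moreover have E: "expectation X = \<mu>"
      by (rule normal_distributed_expectation[OF _ D]) (use v in simp)
    moreover have "expectation (\<lambda>\<omega>. (X \<omega> - \<mu>)\<^sup>2) = v"
      using normal_distributed_variance[OF _ D] v by (simp add: E)
    ultimately show ?thesis by simp
  qed
  then show "square_integrable M X" "expectation X = \<mu>" "expectation (\<lambda>\<omega>. (X \<omega> - \<mu>)\<^sup>2) = v"
    by auto
qed

text \<open>The degenerate case must be treated separately since it has no density; the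
formula for the characteristic function is the same.\<close>

lemma normal_rv_char:
  assumes N: "normal_rv M X \<mu> v"
  shows "expectation (\<lambda>\<omega>. iexp (t * X \<omega>)) = iexp (t * \<mu>) * exp (- (t\<^sup>2 * v / 2))"
proof (cases "v = 0")
  case True
  have [measurable]: "X \<in> borel_measurable M" using N by (simp add: normal_rv_def)
  have "expectation (\<lambda>\<omega>. iexp (t * X \<omega>)) = expectation (\<lambda>_. iexp (t * \<mu>))"
    by (rule integral_cong_AE) (use normal_rv_degenerate[of X \<mu>] N True in auto)
  then show ?thesis using True by (simp add: prob_space)
next
  case False
  have [measurable]: "X \<in> borel_measurable M" using N by (simp add: normal_rv_def)
  define Y where "Y = (\<lambda>\<omega>. (X \<omega> - \<mu>) / sqrt v)"
  have [measurable]: "Y \<in> borel_measurable M" by (simp add: Y_def)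
  from False N have v: "0 < v" and "distributed M lborel X (normal_density \<mu> (sqrt v))"
    by (auto simp: normal_rv_def)
  then have "distributed M lborel Y std_normal_density"
    using normal_standard_normal_convert[of "sqrt v" X \<mu>] by (simp add: Y_def)
  then have D: "distr M borel Y = std_normal_distribution"
    using distributed_distr_eq_density[of M lborel Y] by (simp cong: distr_cong)
  have "expectation (\<lambda>\<omega>. iexp (t * sqrt v * Y \<omega>)) = char (distr M borel Y) (t * sqrt v)"
    by (simp add: char_def integral_distr)
  also have "\<dots> = exp (- (t\<^sup>2 * v / 2))"
    using v by (simp add: D char_std_normal_distribution power_mult_distrib flip: of_real_power of_real_mult)
  finally have *: "expectation (\<lambda>\<omega>. iexp (t * sqrt v * Y \<omega>)) = exp (- (t\<^sup>2 * v / 2))" .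
  have "X \<omega> = \<mu> + sqrt v * Y \<omega>" for \<omega> using v by (simp add: Y_def)
  then have "expectation (\<lambda>\<omega>. iexp (t * X \<omega>)) = expectation (\<lambda>\<omega>. iexp (t * \<mu>) * iexp (t * sqrt v * Y \<omega>))"
    by (simp add: exp_add[symmetric] algebra_simps)
  also have "\<dots> = iexp (t * \<mu>) * expectation (\<lambda>\<omega>. iexp (t * sqrt v * Y \<omega>))"
    by (rule integral_mult_right_zero)
  finally show ?thesis using * by simp
qed

end

text \<open>On the positive half-line the Laplace density is half an exponential density,
so that the substitution $y = x / b$ turns the moments into values of the Gamma function.\<close>

lemma laplace_half_moment:
  assumes "0 < b"
  shows "has_bochner_integral lborel (\<lambda>x. indicator {0..} x *\<^sub>R (laplace_density b x * x ^ k))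
           (b ^ k * fact k / 2)"
proof -
  have m: "has_bochner_integral lborel (\<lambda>x::real. indicator {0..} x *\<^sub>R (x ^ k * exp (- x))) (fact k)"
  proof (rule has_bochner_integral_nn_integral)
    show "(\<integral>\<^sup>+ x. ennreal (indicator {0..} x *\<^sub>R (x ^ k * exp (- x))) \<partial>lborel) = ennreal (fact k)"
      using nn_intergal_power_times_exp_Ici[of k]
      by (simp add: ennreal_mult' ennreal_indicator mult.commute flip: ennreal_of_nat_eq_real_of_nat)
  qed (auto simp: indicator_def)
  \<comment> \<open>The summand 0 gives the argument the affine shape of the substitution rule.\<close>
  have s: "has_bochner_integral lborel
      (\<lambda>x. indicator {0..} (0 + (1 / b) * x) *\<^sub>R ((0 + (1 / b) * x) ^ k * exp (- (0 + (1 / b) * x))))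
      (fact k /\<^sub>R \<bar>1 / b\<bar>)"
    using assms by (subst lborel_has_bochner_integral_real_affine_iff[symmetric]) (use m in auto)
  have "(\<lambda>x. (b ^ k / (2 * b)) * (indicator {0..} (0 + (1 / b) * x) *\<^sub>R
        ((0 + (1 / b) * x) ^ k * exp (- (0 + (1 / b) * x)))))
      = (\<lambda>x. indicator {0..} x *\<^sub>R (laplace_density b x * x ^ k))"
    using assms by (auto simp: fun_eq_iff laplace_density_def indicator_def field_simps)
  with has_bochner_integral_mult_right[OF s, of "b ^ k / (2 * b)"] assms show ?thesis
    by (simp add: field_simps)
qed

lemma (in prob_space) laplace_rv_moments:
  assumes D: "laplace_rv M X b" and b: "0 < b"
  shows "square_integrable M X" and "expectation X = 0" and "expectation (\<lambda>\<omega>. (X \<omega>)\<^sup>2) = 2 * b\<^sup>2"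
proof -
  have D: "distributed M lborel X (\<lambda>w. ennreal (laplace_density b w))"
    using D by (simp add: laplace_rv_def)
  have X[measurable]: "X \<in> borel_measurable M" using distributed_measurable[OF D] by simp
  have nn: "0 \<le> laplace_density b x" for x using b by (simp add: laplace_density_def)
  have 1: "has_bochner_integral lborel (\<lambda>x. laplace_density b x * x ^ 1) 0"
    by (rule has_bochner_integral_odd_function[OF laplace_half_moment[OF b]])
       (simp add: laplace_density_def)
  have 2: "has_bochner_integral lborel (\<lambda>x. laplace_density b x * x\<^sup>2) (2 *\<^sub>R (b\<^sup>2 * fact 2 / 2))"
    by (rule has_bochner_integral_even_function[OF laplace_half_moment[OF b]])
       (simp add: laplace_density_def)
  show "expectation X = 0"
    using distributed_integral[OF D, of "\<lambda>x. x"] nn 1 by (simp add: has_bochner_integral_iff)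
  show "expectation (\<lambda>\<omega>. (X \<omega>)\<^sup>2) = 2 * b\<^sup>2"
    using distributed_integral[OF D, of "\<lambda>x. x\<^sup>2"] nn 2 by (simp add: has_bochner_integral_iff)
  show "square_integrable M X"
    using distributed_integrable[OF D, of "\<lambda>x. x\<^sup>2"] nn 2
    by (simp add: has_bochner_integral_iff square_integrable_real)
qed

section \<open>A Fourier criterion for vanishing conditional expectation\<close>

context prob_space
begin

lemma subalgebra_generated:
  fixes Y :: "'a \<Rightarrow> real"
  assumes "Y \<in> borel_measurable M"
  shows "finite_measure_subalgebra M (generated_algebra M Y)"
proof
  show "subalgebra M (generated_algebra M Y)"
    using assms sets_vimage_algebra2[of Y "space M" borel]
    by (auto simp: subalgebra_def generated_algebra_def dest: measurable_sets)
qed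

lemma measurable_generated:
  fixes Y :: "'a \<Rightarrow> real"
  assumes "h \<in> borel_measurable borel"
  shows "(\<lambda>\<omega>. h (Y \<omega>)) \<in> borel_measurable (generated_algebra M Y)"
  unfolding generated_algebra_def
  by (rule measurable_compose[OF measurable_vimage_algebra1 assms]) simp

text \<open>A nonnegative weight of total mass one, used as a density on the probability
space, changes the law of $Y$; this expresses the weighted expectations of functions of $Y$ by a
probability measure on the real line, to which Levy's uniqueness theorem applies.\<close>

lemma weighted_law:
  assumes Y: "Y \<in> borel_measurable M" and w: "integrable M w" and nn: "\<And>\<omega>. 0 \<le> w \<omega>"
    and tot: "expectation w = 1"
  defines "N \<equiv> distr (density M (\<lambda>\<omega>. ennreal (w \<omega>))) borel Y"
  shows "real_distribution N"
    and "char N t = expectation (\<lambda>\<omega>. w \<omega> *\<^sub>R iexp (t * Y \<omega>))"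
    and "B \<in> sets borel \<Longrightarrow> measure N B = expectation (\<lambda>\<omega>. w \<omega> * indicator B (Y \<omega>))"
proof -
  have [measurable]: "Y \<in> borel_measurable M" "w \<in> borel_measurable M" using Y w by auto
  have "prob_space (density M (\<lambda>\<omega>. ennreal (w \<omega>)))"
    by (rule prob_spaceI) (simp add: emeasure_density nn_integral_eq_integral w nn tot cong: nn_integral_cong_simp)
  then have "prob_space N" unfolding N_def by (rule prob_space.prob_space_distr) simp
  then show "real_distribution N"
    by (simp add: real_distribution_def real_distribution_axioms_def N_def)
  show "char N t = expectation (\<lambda>\<omega>. w \<omega> *\<^sub>R iexp (t * Y \<omega>))"
    unfolding char_def N_def by (simp add: integral_distr integral_density nn)
  assume [measurable]: "B \<in> sets borel"
  have "measure N B = integral\<^sup>L N (indicator B)"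
    by (simp add: N_def)
  also have "\<dots> = expectation (\<lambda>\<omega>. w \<omega> * indicator B (Y \<omega>))"
    unfolding N_def by (subst integral_distr) (simp_all add: integral_density nn)
  finally show "measure N B = expectation (\<lambda>\<omega>. w \<omega> * indicator B (Y \<omega>))" .
qed

text \<open>The signed measure with density $e$ has, pushed forward by $Y$, a
vanishing Fourier transform. Splitting $e$ into positive and negative parts, which have equal mass by the
case $t = 0$, and normalising reduces this to uniqueness for probability measures.\<close>

lemma fourier_zero_imp_zero_on_events:
  assumes Y: "Y \<in> borel_measurable M" and e: "integrable M e"
    and fourier: "\<And>t. expectation (\<lambda>\<omega>. e \<omega> *\<^sub>R iexp (t * Y \<omega>)) = 0"
    and B: "B \<in> sets borel"
  shows "expectation (\<lambda>\<omega>. e \<omega> * indicator B (Y \<omega>)) = 0"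
proof -
  have [measurable]: "Y \<in> borel_measurable M" "e \<in> borel_measurable M" "B \<in> sets borel"
    using Y e B by auto
  define p n where "p = (\<lambda>\<omega>. max 0 (e \<omega>))" and "n = (\<lambda>\<omega>. max 0 (- e \<omega>))"
  have e_eq: "e = (\<lambda>\<omega>. p \<omega> - n \<omega>)" by (auto simp: p_def n_def max_def)
  have [simp]: "0 \<le> p \<omega>" "0 \<le> n \<omega>" for \<omega> by (simp_all add: p_def n_def)
  have p: "integrable M p" and n: "integrable M n"
    using e by (auto simp: p_def n_def)
  have pb: "integrable M (\<lambda>\<omega>. p \<omega> *\<^sub>R f (Y \<omega>))" and nb: "integrable M (\<lambda>\<omega>. n \<omega> *\<^sub>R f (Y \<omega>))"
    if [measurable]: "f \<in> borel_measurable borel" and "\<And>y. norm (f y) \<le> 1"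
    for f :: "real \<Rightarrow> 'b::{banach, second_countable_topology}"
  proof -
    note [measurable] = borel_measurable_integrable[OF p] borel_measurable_integrable[OF n]
    show "integrable M (\<lambda>\<omega>. p \<omega> *\<^sub>R f (Y \<omega>))"
      by (rule Bochner_Integration.integrable_bound[OF p]) (use that(2) in \<open>auto intro!: mult_left_le\<close>)
    show "integrable M (\<lambda>\<omega>. n \<omega> *\<^sub>R f (Y \<omega>))"
      by (rule Bochner_Integration.integrable_bound[OF n]) (use that(2) in \<open>auto intro!: mult_left_le\<close>)
  qed
  have four: "expectation (\<lambda>\<omega>. p \<omega> *\<^sub>R iexp (t * Y \<omega>)) = expectation (\<lambda>\<omega>. n \<omega> *\<^sub>R iexp (t * Y \<omega>))" for t
    using fourier[of t] pb[of "\<lambda>y. iexp (t * y)"] nb[of "\<lambda>y. iexp (t * y)"]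
    by (simp add: e_eq scaleR_left_diff_distrib)
  \<comment> \<open>The common mass of the two parts; for mass zero there is nothing to normalise.\<close>
  define c where "c = expectation p"
  have cn: "expectation n = c"
  proof -
    have "of_real (expectation p) = (of_real (expectation n) :: complex)"
      using four[of 0] by (simp add: scaleR_conv_of_real)
    then show ?thesis by (simp add: c_def)
  qed
  show ?thesis
  proof (cases "c = 0")
    case True
    have "AE \<omega> in M. p \<omega> = 0" "AE \<omega> in M. n \<omega> = 0"
      using True cn integral_nonneg_eq_0_iff_AE[OF p] integral_nonneg_eq_0_iff_AE[OF n] by (auto simp: c_def)
    then have "AE \<omega> in M. e \<omega> * indicator B (Y \<omega>) = 0"
      by eventually_elim (simp add: e_eq)
    then show ?thesis by (rule integral_eq_zero_AE)
  next
    case False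
    have c: "0 < c" using False by (simp add: c_def order_less_le)
    define N where "N = (\<lambda>w. distr (density M (\<lambda>\<omega>. ennreal (w \<omega> / c))) borel Y)"
    note P = weighted_law[OF Y, of "\<lambda>\<omega>. p \<omega> / c", folded N_def]
    note Q = weighted_law[OF Y, of "\<lambda>\<omega>. n \<omega> / c", folded N_def]
    have char_eq: "char (N p) = char (N n)"
    proof
      fix t
      have "expectation (\<lambda>\<omega>. (p \<omega> / c) *\<^sub>R iexp (t * Y \<omega>)) = (1 / c) *\<^sub>R expectation (\<lambda>\<omega>. p \<omega> *\<^sub>R iexp (t * Y \<omega>))"
        by (subst integral_scaleR_right[symmetric]) simp
      also have "\<dots> = expectation (\<lambda>\<omega>. (n \<omega> / c) *\<^sub>R iexp (t * Y \<omega>))"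
        by (subst four, subst integral_scaleR_right[symmetric]) simp
      finally show "char (N p) t = char (N n) t"
        using P(2) Q(2) p n c cn by (simp add: N_def c_def)
    qed
    have "N p = N n"
      by (rule Levy_uniqueness[OF _ _ char_eq]) (use P(1) Q(1) p n c cn in \<open>simp_all add: N_def c_def\<close>)
    then have "expectation (\<lambda>\<omega>. p \<omega> / c * indicator B (Y \<omega>)) = expectation (\<lambda>\<omega>. n \<omega> / c * indicator B (Y \<omega>))"
      using P(3)[OF _ _ _ B] Q(3)[OF _ _ _ B] p n c cn by (simp add: N_def c_def)
    then have "expectation (\<lambda>\<omega>. p \<omega> * indicator B (Y \<omega>)) = expectation (\<lambda>\<omega>. n \<omega> * indicator B (Y \<omega>))"
      using c by simp
    moreover have "expectation (\<lambda>\<omega>. e \<omega> * indicator B (Y \<omega>)) =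
        expectation (\<lambda>\<omega>. p \<omega> * indicator B (Y \<omega>)) - expectation (\<lambda>\<omega>. n \<omega> * indicator B (Y \<omega>))"
      using pb[of "indicator B :: real \<Rightarrow> real"] nb[of "indicator B :: real \<Rightarrow> real"]
      by (simp add: e_eq left_diff_distrib indicator_def)
    ultimately show ?thesis by simp
  qed
qed

text \<open>This is the derivative at $s = 0$ of the factored characteristic
function: the left-hand side has derivative $i E[e \, e^{itY}]$, and the right-hand side has derivative
$\phi(t) \cdot i E[e] = 0$. Rather than differentiating under the integral, one uses the second-order
bound $|e^{ix} - 1 - ix| \<le> x^2 / 2$, which yields
$|s| \, |E[e \, e^{itY}]| \<le> s^2 E[e^2]$ for all $s$; letting $s$ be small forces the claim.\<close>

lemma factoring_char_imp_fourier_zero: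
  assumes Y: "Y \<in> borel_measurable M" and e: "square_integrable M e" and mean: "expectation e = 0"
    and factor: "\<And>s t. expectation (\<lambda>\<omega>. iexp (t * Y \<omega> + s * e \<omega>)) =
                  expectation (\<lambda>\<omega>. iexp (t * Y \<omega>)) * expectation (\<lambda>\<omega>. iexp (s * e \<omega>))"
  shows "expectation (\<lambda>\<omega>. e \<omega> *\<^sub>R iexp (t * Y \<omega>)) = 0"
proof (rule ccontr)
  have [measurable]: "Y \<in> borel_measurable M" "e \<in> borel_measurable M"
    using Y e by (auto simp: square_integrable_real)
  have int: "integrable M (\<lambda>\<omega>. g \<omega> *\<^sub>R iexp (t * Y \<omega>))"
    if "integrable M g" for g :: "'a \<Rightarrow> real" and t
    by (rule Bochner_Integration.integrable_bound[OF that]) (use that in \<open>auto\<close>)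
  have ie: "integrable M e" by (rule square_integrable_integrable[OF e])
  define G where "G = expectation (\<lambda>\<omega>. e \<omega> *\<^sub>R iexp (t * Y \<omega>))"
  define \<phi> where "\<phi> = expectation (\<lambda>\<omega>. iexp (t * Y \<omega>))"
  define v where "v = expectation (\<lambda>\<omega>. (e \<omega>)\<^sup>2)"
  have approx: "cmod (expectation (\<lambda>\<omega>. iexp (r * Y \<omega>) * (iexp (s * e \<omega>) - 1 - \<i> * (s * e \<omega>)))) \<le> s\<^sup>2 * v / 2"
    for r s
  proof -
    have i: "integrable M (\<lambda>\<omega>. s\<^sup>2 / 2 * (e \<omega>)\<^sup>2)"
      using e by (simp add: square_integrable_real)
    have b: "cmod (iexp (r * Y \<omega>) * (iexp (s * e \<omega>) - 1 - \<i> * (s * e \<omega>))) \<le> s\<^sup>2 / 2 * (e \<omega>)\<^sup>2" for \<omega>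
    proof -
      have unit: "cmod (iexp (r * Y \<omega>) * z) = cmod z" for z by (simp add: norm_mult del: of_real_mult)
      show ?thesis
        unfolding unit using iexp_approx1[of "s * e \<omega>" 1]
        by (simp add: power_mult_distrib numeral_2_eq_2[symmetric] algebra_simps)
    qed
    have "cmod (expectation (\<lambda>\<omega>. iexp (r * Y \<omega>) * (iexp (s * e \<omega>) - 1 - \<i> * (s * e \<omega>))))
        \<le> expectation (\<lambda>\<omega>. s\<^sup>2 / 2 * (e \<omega>)\<^sup>2)"
    proof (rule order_trans[OF integral_norm_bound integral_mono[OF integrable_norm i]])
      show "integrable M (\<lambda>\<omega>. iexp (r * Y \<omega>) * (iexp (s * e \<omega>) - 1 - \<i> * (s * e \<omega>)))"
        by (rule Bochner_Integration.integrable_bound[OF i], measurable,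
            rule AE_I2, rule order_trans[OF b]) simp
    qed (rule b)
    also have "\<dots> = s\<^sup>2 * v / 2" by (simp add: v_def)
    finally show ?thesis .
  qed
  have expand: "expectation (\<lambda>\<omega>. iexp (r * Y \<omega>) * (iexp (s * e \<omega>) - 1 - \<i> * (s * e \<omega>)))
      = expectation (\<lambda>\<omega>. iexp (r * Y \<omega> + s * e \<omega>)) - expectation (\<lambda>\<omega>. iexp (r * Y \<omega>))
        - \<i> * s * expectation (\<lambda>\<omega>. e \<omega> *\<^sub>R iexp (r * Y \<omega>))" for r s
  proof -
    have 1: "integrable M (\<lambda>\<omega>. iexp (r * Y \<omega> + s * e \<omega>))" "integrable M (\<lambda>\<omega>. iexp (r * Y \<omega>))"
      by (auto intro!: integrable_const_bound[where B=1])
    have 2: "integrable M (\<lambda>\<omega>. (\<i> * s) * (e \<omega> *\<^sub>R iexp (r * Y \<omega>)))"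
      using int[OF ie] by (rule integrable_mult_right)
    have "(\<lambda>\<omega>. iexp (r * Y \<omega>) * (iexp (s * e \<omega>) - 1 - \<i> * (s * e \<omega>)))
       = (\<lambda>\<omega>. iexp (r * Y \<omega> + s * e \<omega>) - iexp (r * Y \<omega>) - (\<i> * s) * (e \<omega> *\<^sub>R iexp (r * Y \<omega>)))"
      by (simp add: fun_eq_iff exp_add algebra_simps scaleR_conv_of_real)
    then show ?thesis
      using 1 2 by (simp add: Bochner_Integration.integral_diff del: of_real_add of_real_mult mult_scaleR_right)
  qed
  have bound: "\<bar>s\<bar> * cmod G \<le> s\<^sup>2 * v" for s
  proof -
    define \<psi> where "\<psi> = expectation (\<lambda>\<omega>. iexp (s * e \<omega>))"
    have 1: "cmod (\<phi> * \<psi> - \<phi> - \<i> * s * G) \<le> s\<^sup>2 * v / 2"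
      using approx[of t s] unfolding expand factor by (simp add: \<phi>_def \<psi>_def G_def)
    have 2: "cmod (\<psi> - 1) \<le> s\<^sup>2 * v / 2"
      using approx[of 0 s] unfolding expand
      by (simp add: \<psi>_def mean prob_space scaleR_conv_of_real)
    have 3: "cmod \<phi> \<le> 1"
      unfolding \<phi>_def by (rule order_trans[OF integral_norm_bound]) (simp add: prob_space)
    have "\<i> * s * G = \<phi> * (\<psi> - 1) - (\<phi> * \<psi> - \<phi> - \<i> * s * G)" by (simp add: algebra_simps)
    then have "cmod (\<i> * s * G) \<le> cmod (\<phi> * (\<psi> - 1)) + cmod (\<phi> * \<psi> - \<phi> - \<i> * s * G)"
      by (metis norm_triangle_ineq4)
    also have "cmod (\<phi> * (\<psi> - 1)) \<le> 1 * cmod (\<psi> - 1)"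
      unfolding norm_mult by (rule mult_right_mono[OF 3]) simp
    finally show ?thesis using 1 2 by (simp add: norm_mult)
  qed
  assume "expectation (\<lambda>\<omega>. e \<omega> *\<^sub>R iexp (t * Y \<omega>)) \<noteq> 0"
  then have G: "0 < cmod G" by (simp add: G_def)
  have v: "0 \<le> v" by (simp add: v_def)
  \<comment> \<open>Any positive number below the ratio of the norm of G to v contradicts the bound; the summand 1 covers v = 0.\<close>
  define s where "s = cmod G / 2 / (v + 1)"
  have s: "0 < s" using G v by (simp add: s_def)
  have "s * cmod G \<le> s * (s * v)" using bound[of s] s by (simp add: power2_eq_square mult.assoc)
  then have "cmod G \<le> s * v" using s by simp
  also have "\<dots> \<le> s * (v + 1)" using s by simp
  also have "\<dots> = cmod G / 2"
  proof -
    have "v + 1 \<noteq> 0" using v by simp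
    then show ?thesis unfolding s_def by (rule nonzero_eq_divide_eq[THEN iffD1]) (rule refl)
  qed
  finally show False using G by simp
qed

text \<open>Factoring of the joint characteristic function is equivalent to
independence of $Y$ and $e$, which for $e$ of mean zero would give the claim at once; the route through the
signed measure needs uniqueness of characteristic functions in dimension one only.\<close>

lemma cond_exp_zero_of_factoring_char:
  assumes Y: "Y \<in> borel_measurable M" and e: "square_integrable M e" and mean: "expectation e = 0"
    and factor: "\<And>s t. expectation (\<lambda>\<omega>. iexp (t * Y \<omega> + s * e \<omega>)) =
                  expectation (\<lambda>\<omega>. iexp (t * Y \<omega>)) * expectation (\<lambda>\<omega>. iexp (s * e \<omega>))"
  shows "AE \<omega> in M. real_cond_exp M (generated_algebra M Y) e \<omega> = 0"
proof -
  interpret S: finite_measure_subalgebra M "generated_algebra M Y" by (rule subalgebra_generated[OF Y])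
  show ?thesis
  proof (rule S.real_cond_exp_charact)
    show "integrable M e" by (rule square_integrable_integrable[OF e])
    fix A assume "A \<in> sets (generated_algebra M Y)"
    then obtain B where B: "B \<in> sets borel" and A: "A = Y -` B \<inter> space M"
      using sets_vimage_algebra2[of Y "space M" borel] by (auto simp: generated_algebra_def)
    have "(LINT \<omega>:A|M. e \<omega>) = expectation (\<lambda>\<omega>. e \<omega> * indicator B (Y \<omega>))"
      unfolding set_lebesgue_integral_def
      by (rule Bochner_Integration.integral_cong) (auto simp: A indicator_def)
    also have "\<dots> = 0"
      by (rule fourier_zero_imp_zero_on_events[OF Y _ _ B])
         (use square_integrable_integrable[OF e] factoring_char_imp_fourier_zero[OF Y e mean factor] in auto)
    finally show "(LINT \<omega>:A|M. e \<omega>) = (LINT \<omega>:A|M. 0)" by (simp add: set_lebesgue_integral_def)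
  qed auto
qed

end

section \<open>Second-order structure of the measurement model\<close>

lemma generated_algebra_compose_subset:
  fixes L :: "'a \<Rightarrow> 'b::topological_space" and f :: "'b \<Rightarrow> real"
  assumes f: "f \<in> borel_measurable borel"
  shows "sets (generated_algebra M (\<lambda>\<omega>. f (L \<omega>))) \<subseteq> sets (generated_algebra M L)"
  unfolding generated_algebra_def
  by (rule sets_image_in_sets)
     (use measurable_compose[OF measurable_vimage_algebra1 f, of L "space M"] in simp_all)

text \<open>Mutual independence of the sources is a statement about a family of sigma-algebras;
the moment and characteristic function computations need it for pairs of real random variables.\<close>

lemma (in prob_space) indep_var_of_indep_sets:
  fixes X Y :: "'a \<Rightarrow> real"
  assumes F: "indep_sets F UNIV" and st: "s \<noteq> t"
    and X: "X \<in> borel_measurable M" "sets (generated_algebra M X) \<subseteq> F s"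
    and Y: "Y \<in> borel_measurable M" "sets (generated_algebra M Y) \<subseteq> F t"
  shows "indep_var borel X borel Y"
proof -
  have ev: "F r \<subseteq> events" for r using F by (simp add: indep_sets_def)
  have "indep_set (sets (generated_algebra M X)) (sets (generated_algebra M Y))"
  proof (rule indep_setI)
    fix a b assume ab: "a \<in> sets (generated_algebra M X)" "b \<in> sets (generated_algebra M Y)"
    then have "prob (\<Inter>r\<in>{s, t}. if r = s then a else b) = (\<Prod>r\<in>{s, t}. prob (if r = s then a else b))"
      using X Y st by (intro indep_setsD[OF F]) auto
    then show "prob (a \<inter> b) = prob a * prob b" using st by (simp add: Int_commute)
  qed (use X Y ev in blast)+
  then show ?thesis
    using X Y by (simp add: indep_var_eq generated_algebra_def sets_vimage_algebra)
qed

locale linear_measurement_model = prob_space M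
  for M :: "'a measure" and L :: "'a \<Rightarrow> real ^ 'n" and W0 :: "'a \<Rightarrow> real" and W :: "'n \<Rightarrow> 'a \<Rightarrow> real"
    and m :: "real ^ 'n" and P :: "real ^ 'n ^ 'n" and R0 :: real and b :: "'n \<Rightarrow> real" +
  assumes cov: "covariance_matrix P"
    and R0_pos: "0 < R0" and b_pos: "\<And>i. 0 < b i"
    and gauss: "gaussian_vector M L m P"
    and normal0: "normal_rv M W0 0 R0"
    and laplace: "\<And>i. laplace_rv M (W i) (b i)"
    and indep: "mutually_indep M L W0 W"
begin

text \<open>The covariance of the random variables $u \cdot L$ and $v \cdot L$, see \<open>signal_cov\<close>.\<close>

abbreviation Pform :: "real ^ 'n \<Rightarrow> real ^ 'n \<Rightarrow> real" where
  "Pform u v \<equiv> u \<bullet> (P *v v)"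

abbreviation noise_var :: "'n \<Rightarrow> real" where
  "noise_var i \<equiv> 2 * (b i)\<^sup>2"

lemma Pform_sym: "Pform u v = Pform v u"
  using cov by (metis covariance_matrix_def dot_lmul_matrix inner_commute matrix_vector_mul_assoc transpose_matrix_vector)

lemma Pform_nonneg: "0 \<le> Pform u u"
  using cov by (simp add: covariance_matrix_def)

lemma Pform_linear:
  "Pform (u + v) w = Pform u w + Pform v w" "Pform w (u + v) = Pform w u + Pform w v"
  "Pform (u - v) w = Pform u w - Pform v w" "Pform w (u - v) = Pform w u - Pform w v"
  "Pform (c *\<^sub>R u) w = c * Pform u w" "Pform w (c *\<^sub>R u) = c * Pform w u"
  by (simp_all add: inner_add_left inner_add_right inner_diff_left inner_diff_right
      matrix_vector_right_distrib matrix_vector_mult_diff_distrib matrix_vector_mult_scaleR)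

definition signal :: "real ^ 'n \<Rightarrow> 'a \<Rightarrow> real" where
  "signal u = (\<lambda>\<omega>. u \<bullet> (L \<omega> - m))"

lemma signal_linear:
  "signal (u + v) \<omega> = signal u \<omega> + signal v \<omega>" "signal (u - v) \<omega> = signal u \<omega> - signal v \<omega>"
  "signal (c *\<^sub>R u) \<omega> = c * signal u \<omega>"
  by (simp_all add: signal_def inner_add_left inner_diff_left)

lemma signal_normal: "normal_rv M (\<lambda>\<omega>. u \<bullet> L \<omega>) (u \<bullet> m) (Pform u u)"
  using gauss by (simp add: gaussian_vector_def)

lemma signal_eq: "signal u = (\<lambda>\<omega>. u \<bullet> L \<omega> - u \<bullet> m)"
  by (simp add: signal_def inner_diff_right)

lemma signal_L2: "square_integrable M (signal u)"
  unfolding signal_eq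
  by (rule square_integrable_diff[OF normal_rv_moments(1)[OF signal_normal] square_integrable_const])

lemma signal_mean: "expectation (signal u) = 0"
  using normal_rv_moments(2)[OF signal_normal, of u]
    square_integrable_integrable[OF normal_rv_moments(1)[OF signal_normal, of u]]
  by (simp add: signal_eq prob_space)

lemma signal_var: "expectation (\<lambda>\<omega>. (signal u \<omega>)\<^sup>2) = Pform u u"
  using normal_rv_moments(3)[OF signal_normal, of u] by (simp add: signal_eq)

text \<open>By polarisation: the hypothesis on $L$ gives the variances of all $u \cdot L$, and thereby all
covariances.\<close>

lemma signal_cov: "expectation (\<lambda>\<omega>. signal u \<omega> * signal v \<omega>) = Pform u v"
proof -
  have "Pform (u + v) (u + v) = expectation (\<lambda>\<omega>. (signal u \<omega>)\<^sup>2 + (signal v \<omega>)\<^sup>2 + 2 * (signal u \<omega> * signal v \<omega>))"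
    unfolding signal_var[symmetric] by (simp add: signal_linear power2_sum mult.assoc)
  also have "\<dots> = Pform u u + Pform v v + 2 * expectation (\<lambda>\<omega>. signal u \<omega> * signal v \<omega>)"
    using signal_L2[of u] signal_L2[of v] square_integrable_mult[OF signal_L2 signal_L2, of u v]
    by (simp add: square_integrable_real signal_var)
  finally show ?thesis using Pform_sym[of u v] by (simp add: Pform_linear)
qed

lemma noise_L2: "square_integrable M W0" "square_integrable M (W i)"
  using normal_rv_moments(1)[OF normal0] laplace_rv_moments(1)[OF laplace b_pos] by auto

lemma noise_mean: "expectation W0 = 0" "expectation (W i) = 0"
  using normal_rv_moments(2)[OF normal0] laplace_rv_moments(2)[OF laplace b_pos] by auto

lemma noise_var: "expectation (\<lambda>\<omega>. (W0 \<omega>)\<^sup>2) = R0" "expectation (\<lambda>\<omega>. (W i \<omega>)\<^sup>2) = noise_var i"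
  using normal_rv_moments(3)[OF normal0] laplace_rv_moments(3)[OF laplace b_pos] by auto

lemma indep_sources:
  shows "indep_var borel (signal u) borel W0"
    and "indep_var borel (signal u) borel (W i)"
    and "indep_var borel W0 borel (W i)"
proof -
  note F = indep[unfolded mutually_indep_def]
  have meas: "signal u \<in> borel_measurable M" "W0 \<in> borel_measurable M" "W i \<in> borel_measurable M"
    using signal_L2 noise_L2 by (auto simp: square_integrable_real)
  have sub: "sets (generated_algebra M (signal u)) \<subseteq> sets (generated_algebra M L)"
    unfolding signal_def by (rule generated_algebra_compose_subset) simp
  show "indep_var borel (signal u) borel W0"
    by (rule indep_var_of_indep_sets[OF F, of Signal Noise0]) (use meas sub in auto)
  show "indep_var borel (signal u) borel (W i)"
    by (rule indep_var_of_indep_sets[OF F, of Signal "Noise i"]) (use meas sub in auto)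
  show "indep_var borel W0 borel (W i)"
    by (rule indep_var_of_indep_sets[OF F, of Noise0 "Noise i"]) (use meas in auto)
qed

lemma sources_uncorrelated:
  "expectation (\<lambda>\<omega>. signal u \<omega> * W0 \<omega>) = 0"
  "expectation (\<lambda>\<omega>. signal u \<omega> * W i \<omega>) = 0"
  "expectation (\<lambda>\<omega>. W0 \<omega> * W i \<omega>) = 0"
  using indep_var_lebesgue_integral[OF indep_sources(1)[of u]]
    indep_var_lebesgue_integral[OF indep_sources(2)[of u i]]
    indep_var_lebesgue_integral[OF indep_sources(3)[of i]]
    square_integrable_integrable[OF signal_L2[of u]] square_integrable_integrable[OF noise_L2(1)]
    square_integrable_integrable[OF noise_L2(2)[of i]] noise_mean
  by (simp_all add: signal_mean)

text \<open>All errors and innovations below are centred linear combinations of the sources and involve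
the noise of one component only, so one covariance formula (\<open>lincomb_cov\<close>) serves them all.\<close>

definition lincomb :: "'n \<Rightarrow> real ^ 'n \<Rightarrow> real \<Rightarrow> real \<Rightarrow> 'a \<Rightarrow> real" where
  "lincomb i u \<alpha> \<beta> = (\<lambda>\<omega>. signal u \<omega> + \<alpha> * W0 \<omega> + \<beta> * W i \<omega>)"

lemma lincomb_L2: "square_integrable M (lincomb i u \<alpha> \<beta>)"
  unfolding lincomb_def
  by (intro square_integrable_add square_integrable_scale signal_L2 noise_L2)

lemma lincomb_mean: "expectation (lincomb i u \<alpha> \<beta>) = 0"
  using square_integrable_integrable[OF signal_L2[of u]] square_integrable_integrable[OF noise_L2(1)]
    square_integrable_integrable[OF noise_L2(2)[of i]]
  by (simp add: lincomb_def signal_mean noise_mean)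

lemma lincomb_cov:
  "expectation (\<lambda>\<omega>. lincomb i u \<alpha> \<beta> \<omega> * lincomb i v \<gamma> \<delta> \<omega>)
     = Pform u v + \<alpha> * \<gamma> * R0 + \<beta> * \<delta> * noise_var i"
proof -
  have "expectation (\<lambda>\<omega>. lincomb i u \<alpha> \<beta> \<omega> * lincomb i v \<gamma> \<delta> \<omega>) = expectation (\<lambda>\<omega>.
      signal u \<omega> * signal v \<omega> + \<gamma> * (signal u \<omega> * W0 \<omega>) + \<delta> * (signal u \<omega> * W i \<omega>)
      + \<alpha> * (signal v \<omega> * W0 \<omega>) + \<beta> * (signal v \<omega> * W i \<omega>)
      + (\<alpha> * \<delta> + \<beta> * \<gamma>) * (W0 \<omega> * W i \<omega>) + \<alpha> * \<gamma> * (W0 \<omega>)\<^sup>2 + \<beta> * \<delta> * (W i \<omega>)\<^sup>2)"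
    by (rule Bochner_Integration.integral_cong)
       (simp_all add: lincomb_def power2_eq_square algebra_simps)
  also have "\<dots> = Pform u v + \<alpha> * \<gamma> * R0 + \<beta> * \<delta> * noise_var i"
    using square_integrable_mult[OF signal_L2[of u] signal_L2[of v]]
      square_integrable_mult[OF signal_L2[of u] noise_L2(1)]
      square_integrable_mult[OF signal_L2[of v] noise_L2(1)]
      square_integrable_mult[OF signal_L2[of u] noise_L2(2)[of i]]
      square_integrable_mult[OF signal_L2[of v] noise_L2(2)[of i]]
      square_integrable_mult[OF noise_L2(1) noise_L2(2)[of i]]
      noise_L2(1) noise_L2(2)[of i]
    by (simp add: square_integrable_real signal_cov sources_uncorrelated noise_var)
  finally show ?thesis .
qed

text \<open>Combinations without Laplace noise are normal; in characteristic functions no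
case distinction about vanishing variances is needed.\<close>

lemma gaussian_char:
  "expectation (\<lambda>\<omega>. iexp (signal u \<omega> + \<alpha> * W0 \<omega>)) = exp (- ((Pform u u + \<alpha>\<^sup>2 * R0) / 2))"
proof -
  have [measurable]: "signal u \<in> borel_measurable M" "W0 \<in> borel_measurable M"
    using signal_L2 noise_L2 by (auto simp: square_integrable_real)
  have ind: "indep_var borel (\<lambda>\<omega>. signal u \<omega>) borel (\<lambda>\<omega>. \<alpha> * W0 \<omega>)"
    using indep_var_compose[OF indep_sources(1)[of u], of "\<lambda>x. x" borel "\<lambda>x. \<alpha> * x" borel]
    by (simp add: comp_def)
  have 1: "expectation (\<lambda>\<omega>. iexp (signal u \<omega>)) = exp (- (Pform u u / 2))"
  proof -
    have "expectation (\<lambda>\<omega>. iexp (signal u \<omega>)) = expectation (\<lambda>\<omega>. iexp (- (u \<bullet> m)) * iexp (1 * (u \<bullet> L \<omega>)))"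
      by (simp add: signal_eq exp_add[symmetric] algebra_simps)
    also have "\<dots> = iexp (- (u \<bullet> m)) * (iexp (u \<bullet> m) * exp (- (Pform u u / 2)))"
      by (subst integral_mult_right_zero, subst normal_rv_char[OF signal_normal]) simp
    also have "\<dots> = exp (- (Pform u u / 2))" by (simp add: mult.assoc[symmetric] exp_add[symmetric])
    finally show ?thesis .
  qed
  have 2: "expectation (\<lambda>\<omega>. iexp (\<alpha> * W0 \<omega>)) = exp (- (\<alpha>\<^sup>2 * R0 / 2))"
    using normal_rv_char[OF normal0, of \<alpha>] by simp
  have "expectation (\<lambda>\<omega>. iexp (signal u \<omega> + \<alpha> * W0 \<omega>))
      = char (distr M borel (\<lambda>\<omega>. signal u \<omega> + \<alpha> * W0 \<omega>)) 1"
    by (simp add: char_def integral_distr)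
  also have "\<dots> = expectation (\<lambda>\<omega>. iexp (signal u \<omega>)) * expectation (\<lambda>\<omega>. iexp (\<alpha> * W0 \<omega>))"
    by (subst char_distr_add[OF ind]) (simp add: char_def integral_distr)
  also have "\<dots> = exp (- ((Pform u u + \<alpha>\<^sup>2 * R0) / 2))"
    unfolding 1 2 by (simp add: exp_add[symmetric] add_divide_distrib flip: of_real_mult)
  finally show ?thesis .
qed

section \<open>Estimation from the sum measurement\<close>

abbreviation ones :: "real ^ 'n" where "ones \<equiv> (\<chi> i. 1)"
abbreviation P0 :: real where "P0 \<equiv> Pform ones ones"
abbreviation Prow :: "'n \<Rightarrow> real" where "Prow j \<equiv> Pform (axis j 1) ones"
abbreviation Pdiag :: "'n \<Rightarrow> real" where "Pdiag j \<equiv> Pform (axis j 1) (axis j 1)"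

text \<open>The regression coefficient of a component on the sum measurement: covariance divided by variance.\<close>

definition slope :: "'n \<Rightarrow> real" where "slope j = Prow j / (P0 + R0)"

text \<open>The residual variance of that regression; it is identified as a mean square error in
\<open>total_err_moments\<close>.\<close>

definition total_mse :: "'n \<Rightarrow> real" where
  "total_mse j = Pdiag j - (Prow j)\<^sup>2 / (P0 + R0)"

text \<open>The optimal coefficient for recovering a variable of variance \<open>total_mse j\<close> from its
sum with uncorrelated noise; the form in the covariance entries is \<open>gain_eq\<close>.\<close>

definition gain :: "'n \<Rightarrow> real" where "gain j = total_mse j / (total_mse j + noise_var j)"

text \<open>The coefficient vector of $L$ in the error of the estimate from the sum measurement.\<close>

definition err_weight :: "'n \<Rightarrow> real ^ 'n" where "err_weight j = axis j 1 - slope j *\<^sub>R ones"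

definition aggregate :: "'a \<Rightarrow> real" where
  "aggregate = (\<lambda>\<omega>. signal ones \<omega> + W0 \<omega>)"

definition total_err :: "'n \<Rightarrow> 'a \<Rightarrow> real" where
  "total_err j = (\<lambda>\<omega>. signal (axis j 1) \<omega> - slope j * aggregate \<omega>)"

text \<open>The random variable \<open>total_err j \<omega> + W j \<omega>\<close> is the innovation of the measurement of the
component.\<close>

definition pair_err :: "'n \<Rightarrow> 'a \<Rightarrow> real" where
  "pair_err j = (\<lambda>\<omega>. total_err j \<omega> - gain j * (total_err j \<omega> + W j \<omega>))"

lemma aggregate_lincomb: "aggregate = lincomb j ones 1 0"
  by (simp add: aggregate_def lincomb_def)

lemma total_err_lincomb: "total_err j = lincomb j (err_weight j) (- slope j) 0"
  by (simp add: total_err_def err_weight_def aggregate_def lincomb_def signal_linear fun_eq_iff algebra_simps)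

lemma innovation_lincomb:
  "(\<lambda>\<omega>. total_err j \<omega> + W j \<omega>) = lincomb j (err_weight j) (- slope j) 1"
  by (simp add: total_err_lincomb lincomb_def)

lemma P0_R0_pos: "0 < P0 + R0"
  using Pform_nonneg[of ones] R0_pos by linarith

lemma slope_mult: "slope j * (P0 + R0) = Prow j"
  using P0_R0_pos by (simp add: slope_def)

text \<open>The covariance of \<open>total_err j\<close> with the centred sum measurement vanishes: this is
the normal equation that determines \<open>slope j\<close>.\<close>

lemma total_err_aggregate_form:
  "Pform (err_weight j) ones - slope j * R0 = 0"
  using slope_mult[of j] by (simp add: err_weight_def Pform_linear algebra_simps)

lemma total_err_form:
  "Pform (err_weight j) (err_weight j) + (slope j)\<^sup>2 * R0 = total_mse j"
proof -
  have "Pform (err_weight j) (err_weight j) + (slope j)\<^sup>2 * R0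
      = Pdiag j - 2 * slope j * Prow j + slope j * (slope j * (P0 + R0))"
    using Pform_sym[of ones "axis j 1"] by (simp add: err_weight_def Pform_linear power2_eq_square algebra_simps)
  also have "\<dots> = Pdiag j - slope j * Prow j" unfolding slope_mult by simp
  also have "\<dots> = total_mse j" by (simp add: total_mse_def slope_def power2_eq_square)
  finally show ?thesis .
qed

lemma total_err_moments:
  shows "square_integrable M (total_err j)" and "expectation (total_err j) = 0"
    and "expectation (\<lambda>\<omega>. (total_err j \<omega>)\<^sup>2) = total_mse j"
  using lincomb_L2 lincomb_mean
    lincomb_cov[of j "err_weight j" "- slope j" 0 "err_weight j" "- slope j" 0]
    total_err_form[of j]
  by (simp_all add: total_err_lincomb power2_eq_square)

text \<open>As a mean square, \<open>total_mse\<close> is nonnegative; for the covariance entries this is the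
Cauchy-Schwarz inequality $P_j^2 \<le> P_{jj} P_0$, weakened by the summand $R_0$.\<close>

lemma total_mse_nonneg: "0 \<le> total_mse j"
  unfolding total_err_moments(3)[symmetric] by simp

lemma noise_var_pos: "0 < noise_var j"
  using b_pos[of j] by simp

lemma gain_bounds: "0 \<le> gain j" "gain j \<le> 1"
proof -
  have pos: "0 < total_mse j + noise_var j" using total_mse_nonneg[of j] noise_var_pos[of j] by linarith
  show "0 \<le> gain j" unfolding gain_def by (rule divide_nonneg_pos[OF total_mse_nonneg pos])
  show "gain j \<le> 1"
    unfolding gain_def divide_le_eq_1_pos[OF pos] using noise_var_pos[of j] by linarith
qed

lemma gain_mult: "gain j * (total_mse j + noise_var j) = total_mse j"
proof -
  have "total_mse j + noise_var j \<noteq> 0" using total_mse_nonneg[of j] noise_var_pos[of j] by linarith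
  then show ?thesis unfolding gain_def by (rule nonzero_eq_divide_eq[THEN iffD1]) (rule refl)
qed

lemma gain_eq:
  "gain j = ((R0 + P0) * Pdiag j - (Prow j)\<^sup>2) / ((R0 + P0) * (Pdiag j + noise_var j) - (Prow j)\<^sup>2)"
proof -
  have D: "(P0 + R0) * total_mse j = (R0 + P0) * Pdiag j - (Prow j)\<^sup>2"
    using P0_R0_pos unfolding total_mse_def right_diff_distrib by (simp add: add.commute)
  have "gain j = ((P0 + R0) * total_mse j) / ((P0 + R0) * (total_mse j + noise_var j))"
    using P0_R0_pos by (simp add: gain_def)
  also have "(P0 + R0) * (total_mse j + noise_var j) = (R0 + P0) * (Pdiag j + noise_var j) - (Prow j)\<^sup>2"
    unfolding distrib_left D by (simp add: algebra_simps)
  finally show ?thesis unfolding D .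
qed

lemma aggregate_measurable: "aggregate \<in> borel_measurable M"
  \<comment> \<open>Any index will do: the Laplace noise has coefficient zero.\<close>
  using lincomb_L2[of undefined ones 1 0] aggregate_lincomb[of undefined] by (simp add: square_integrable_real)

text \<open>The exponent of the joint characteristic function is a quadratic form in $(r, s)$ whose mixed
term is the covariance of \<open>total_err j\<close> and \<open>aggregate\<close>. It vanishes by
\<open>total_err_aggregate_form\<close>, so the function factors. The constant $c$ stands for the mean of the sum.\<close>

lemma total_err_cond_exp_zero:
  "AE \<omega> in M. real_cond_exp M (generated_algebra M (\<lambda>\<omega>. c + aggregate \<omega>)) (total_err j) \<omega> = 0"
proof (rule cond_exp_zero_of_factoring_char)
  show "(\<lambda>\<omega>. c + aggregate \<omega>) \<in> borel_measurable M" using aggregate_measurable by simp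
  show "square_integrable M (total_err j)" "expectation (total_err j) = 0" by (rule total_err_moments)+
  fix s t
  have joint: "expectation (\<lambda>\<omega>. iexp (r * (c + aggregate \<omega>) + s * total_err j \<omega>))
      = iexp (r * c) * exp (- ((r\<^sup>2 * (P0 + R0) + s\<^sup>2 * total_mse j) / 2))" for r s
  proof -
    have "expectation (\<lambda>\<omega>. iexp (r * (c + aggregate \<omega>) + s * total_err j \<omega>))
      = expectation (\<lambda>\<omega>. iexp (r * c) * iexp (signal (r *\<^sub>R ones + s *\<^sub>R err_weight j) \<omega> + (r - s * slope j) * W0 \<omega>))"
      by (simp add: total_err_lincomb aggregate_lincomb[of j] lincomb_def signal_linear
          exp_add[symmetric] algebra_simps)
    also have "\<dots> = iexp (r * c) * exp (- ((Pform (r *\<^sub>R ones + s *\<^sub>R err_weight j) (r *\<^sub>R ones + s *\<^sub>R err_weight j)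
        + (r - s * slope j)\<^sup>2 * R0) / 2))"
      by (subst integral_mult_right_zero, subst gaussian_char) simp
    also have "Pform (r *\<^sub>R ones + s *\<^sub>R err_weight j) (r *\<^sub>R ones + s *\<^sub>R err_weight j) + (r - s * slope j)\<^sup>2 * R0
       = r\<^sup>2 * (P0 + R0) + 2 * r * s * (Pform (err_weight j) ones - slope j * R0) + s\<^sup>2 * (Pform (err_weight j) (err_weight j) + (slope j)\<^sup>2 * R0)"
      unfolding Pform_linear(1,2,5,6) Pform_sym[of ones "err_weight j"]
      by (simp add: power2_eq_square algebra_simps)
    also have "\<dots> = r\<^sup>2 * (P0 + R0) + s\<^sup>2 * total_mse j" unfolding total_err_aggregate_form total_err_form by simp
    finally show ?thesis .
  qed
  show "expectation (\<lambda>\<omega>. iexp (t * (c + aggregate \<omega>) + s * total_err j \<omega>))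
      = expectation (\<lambda>\<omega>. iexp (t * (c + aggregate \<omega>))) * expectation (\<lambda>\<omega>. iexp (s * total_err j \<omega>))"
    using joint[of t s] joint[of t 0] joint[of 0 s]
    by (simp add: mult_exp_exp add_divide_distrib flip: of_real_mult)
qed

section \<open>The combined error and its orthogonality\<close>

lemma pair_err_lincomb:
  "pair_err j = lincomb j ((1 - gain j) *\<^sub>R err_weight j) (- (1 - gain j) * slope j) (- gain j)"
  by (simp add: pair_err_def total_err_lincomb lincomb_def signal_linear fun_eq_iff algebra_simps)

text \<open>The defining equation of the gain, $K (q + R) = q$, turns
$(1-K)^2 q + K^2 R$ into $q (1 - K)$.\<close>

lemma pair_err_mean_square: "expectation (\<lambda>\<omega>. (pair_err j \<omega>)\<^sup>2) = total_mse j * (1 - gain j)"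
proof -
  have "expectation (\<lambda>\<omega>. (pair_err j \<omega>)\<^sup>2) = expectation (\<lambda>\<omega>. pair_err j \<omega> * pair_err j \<omega>)"
    by (simp add: power2_eq_square)
  also have "\<dots> =
     (1 - gain j)\<^sup>2 * (Pform (err_weight j) (err_weight j) + (slope j)\<^sup>2 * R0) + (gain j)\<^sup>2 * noise_var j"
    unfolding pair_err_lincomb lincomb_cov
    by (simp add: Pform_linear(5,6) power2_eq_square algebra_simps)
  also have "\<dots> = total_mse j * (1 - gain j) + gain j * (gain j * (total_mse j + noise_var j) - total_mse j)"
    unfolding total_err_form by (simp add: power2_eq_square algebra_simps)
  finally show ?thesis unfolding gain_mult by simp
qed

text \<open>The error is orthogonal to \<open>aggregate\<close> because both \<open>total_err j\<close> and the noise are, and to the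
innovation because $(1 - K) q - K R = 0$.\<close>

lemma pair_err_orthogonal:
  "expectation (\<lambda>\<omega>. pair_err j \<omega> * (c + \<alpha> * aggregate \<omega> + \<beta> * (total_err j \<omega> + W j \<omega>))) = 0"
proof -
  have cross: "expectation (\<lambda>\<omega>. pair_err j \<omega> * aggregate \<omega>) = 0"
  proof -
    have "expectation (\<lambda>\<omega>. pair_err j \<omega> * aggregate \<omega>) = (1 - gain j) * (Pform (err_weight j) ones - slope j * R0)"
      unfolding pair_err_lincomb aggregate_lincomb[of j] lincomb_cov
      by (simp add: Pform_linear(5) algebra_simps)
    then show ?thesis unfolding total_err_aggregate_form by simp
  qed
  have innov: "expectation (\<lambda>\<omega>. pair_err j \<omega> * (total_err j \<omega> + W j \<omega>)) = 0"
  proof -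
    have "expectation (\<lambda>\<omega>. pair_err j \<omega> * lincomb j (err_weight j) (- slope j) 1 \<omega>)
        = (1 - gain j) * (Pform (err_weight j) (err_weight j) + (slope j)\<^sup>2 * R0) - gain j * noise_var j"
      unfolding pair_err_lincomb lincomb_cov
      by (simp add: Pform_linear(5) power2_eq_square algebra_simps)
    also have "\<dots> = total_mse j - gain j * (total_mse j + noise_var j)"
      unfolding total_err_form by (simp add: algebra_simps)
    finally show ?thesis
      unfolding gain_mult using fun_cong[OF innovation_lincomb[of j]] by simp
  qed
  have L2: "square_integrable M (pair_err j)" "square_integrable M aggregate"
      "square_integrable M (\<lambda>\<omega>. total_err j \<omega> + W j \<omega>)"
    using lincomb_L2 by (simp_all add: pair_err_lincomb aggregate_lincomb[of j] innovation_lincomb)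
  have "expectation (\<lambda>\<omega>. pair_err j \<omega> * (c + \<alpha> * aggregate \<omega> + \<beta> * (total_err j \<omega> + W j \<omega>)))
      = expectation (\<lambda>\<omega>. c * pair_err j \<omega> + \<alpha> * (pair_err j \<omega> * aggregate \<omega>)
          + \<beta> * (pair_err j \<omega> * (total_err j \<omega> + W j \<omega>)))"
    by (rule Bochner_Integration.integral_cong) (simp_all add: algebra_simps)
  also have "\<dots> = 0"
    using square_integrable_integrable[OF L2(1)] square_integrable_mult[OF L2(1,2)]
      square_integrable_mult[OF L2(1,3)] cross innov lincomb_mean
    by (simp add: pair_err_lincomb)
  finally show ?thesis .
qed

section \<open>Optimality of the two estimates\<close>

definition total :: "'a \<Rightarrow> real" where
  "total = (\<lambda>\<omega>. (\<Sum>i\<in>UNIV. L \<omega> $ i) + W0 \<omega>)"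

lemma component_eq: "L \<omega> $ j = m $ j + signal (axis j 1) \<omega>"
  by (simp add: signal_def inner_axis')

lemma total_eq: "total = (\<lambda>\<omega>. (\<Sum>i\<in>UNIV. m $ i) + aggregate \<omega>)"
  by (simp add: total_def aggregate_def signal_def inner_vec_def sum_subtractf fun_eq_iff)

lemma component_L2: "square_integrable M (\<lambda>\<omega>. L \<omega> $ j)"
  unfolding component_eq by (intro square_integrable_add square_integrable_const signal_L2)

lemma total_L2: "square_integrable M total"
  \<comment> \<open>As the Laplace noise has coefficient zero, any index will do.\<close>
  unfolding total_eq aggregate_lincomb[of undefined]
  by (intro square_integrable_add square_integrable_const lincomb_L2)

lemma total_cond_exp_total_err:
  "AE \<omega> in M. real_cond_exp M (generated_algebra M total) (total_err j) \<omega> = 0"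
  unfolding total_eq by (rule total_err_cond_exp_zero)

definition total_est :: "'n \<Rightarrow> 'a \<Rightarrow> real" where
  "total_est j = (\<lambda>\<omega>. m $ j + slope j * (total \<omega> - (\<Sum>i\<in>UNIV. m $ i)))"

definition pair_est :: "'n \<Rightarrow> 'a \<Rightarrow> real" where
  "pair_est j = (\<lambda>\<omega>. total_est j \<omega> + gain j * ((L \<omega> $ j + W j \<omega> - m $ j)
                 - slope j * (total \<omega> - (\<Sum>i\<in>UNIV. m $ i))))"

lemma total_est_error: "L \<omega> $ j - total_est j \<omega> = total_err j \<omega>"
  by (simp add: total_est_def total_eq component_eq total_err_def)

lemma pair_est_error: "L \<omega> $ j - pair_est j \<omega> = pair_err j \<omega>"
  unfolding pair_err_def total_est_error[symmetric]
  by (simp add: pair_est_def total_est_def total_eq algebra_simps)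

lemma total_est_L2: "square_integrable M (total_est j)"
proof -
  have "total_est j = (\<lambda>\<omega>. (m $ j - slope j * (\<Sum>i\<in>UNIV. m $ i)) + slope j * total \<omega>)"
    by (simp add: total_est_def algebra_simps)
  then show ?thesis
    by (simp only:) (intro square_integrable_add square_integrable_const square_integrable_scale total_L2)
qed

text \<open>Since the error has conditional expectation zero given the sum measurement, it is orthogonal to
every square-integrable function of it, in particular to the difference of \<open>total_est j\<close> and a competing estimate.\<close>

lemma total_est_best:
  assumes h: "h \<in> borel_measurable borel" and hL2: "square_integrable M (\<lambda>\<omega>. h (total \<omega>))"
  shows "mse M (\<lambda>\<omega>. L \<omega> $ j) (total_est j) \<le> mse M (\<lambda>\<omega>. L \<omega> $ j) (\<lambda>\<omega>. h (total \<omega>))"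
    and "mse M (\<lambda>\<omega>. L \<omega> $ j) (\<lambda>\<omega>. h (total \<omega>)) \<le> mse M (\<lambda>\<omega>. L \<omega> $ j) (total_est j)
      \<Longrightarrow> AE \<omega> in M. h (total \<omega>) = total_est j \<omega>"
proof -
  have T: "total \<in> borel_measurable M" using total_L2 by (simp add: square_integrable_real)
  interpret S: finite_measure_subalgebra M "generated_algebra M total" by (rule subalgebra_generated[OF T])
  define g where "g = (\<lambda>x. m $ j + slope j * (x - (\<Sum>i\<in>UNIV. m $ i)) - h x)"
  have g: "g \<in> borel_measurable borel" unfolding g_def using h by measurable
  have diff: "g (total \<omega>) = total_est j \<omega> - h (total \<omega>)" for \<omega> by (simp add: g_def total_est_def)
  have gL2: "square_integrable M (\<lambda>\<omega>. g (total \<omega>))"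
    unfolding diff by (rule square_integrable_diff[OF total_est_L2 hL2])
  have err: "total_err j \<in> borel_measurable M" using total_err_moments(1) by (simp add: square_integrable_real)
  have gm: "(\<lambda>\<omega>. g (total \<omega>)) \<in> borel_measurable (generated_algebra M total)"
    by (rule measurable_generated[OF g])
  have "expectation (\<lambda>\<omega>. g (total \<omega>) * total_err j \<omega>)
      = expectation (\<lambda>\<omega>. g (total \<omega>) * real_cond_exp M (generated_algebra M total) (total_err j) \<omega>)"
    by (rule S.real_cond_exp_intg(2)[symmetric]) (use square_integrable_mult[OF gL2 total_err_moments(1)] gm err in auto)
  also have "\<dots> = 0"
    by (rule integral_eq_zero_AE) (use total_cond_exp_total_err[of j] in auto)
  finally have orth: "expectation (\<lambda>\<omega>. (L \<omega> $ j - total_est j \<omega>) * (total_est j \<omega> - h (total \<omega>))) = 0"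
    unfolding total_est_error diff[symmetric] by (simp add: mult.commute)
  show "mse M (\<lambda>\<omega>. L \<omega> $ j) (total_est j) \<le> mse M (\<lambda>\<omega>. L \<omega> $ j) (\<lambda>\<omega>. h (total \<omega>))"
    by (rule orthogonal_error_best(1)[OF component_L2 total_est_L2 hL2 orth])
  show "AE \<omega> in M. h (total \<omega>) = total_est j \<omega>"
    if "mse M (\<lambda>\<omega>. L \<omega> $ j) (\<lambda>\<omega>. h (total \<omega>)) \<le> mse M (\<lambda>\<omega>. L \<omega> $ j) (total_est j)"
    by (rule orthogonal_error_best(2)[OF component_L2 total_est_L2 hL2 orth that])
qed

lemma total_est_mmse:
  "is_mmse_estimate M (\<lambda>\<omega>. L \<omega> $ j) total (total_est j)"
  "is_mmse_estimate M (\<lambda>\<omega>. L \<omega> $ j) total V \<Longrightarrow> AE \<omega> in M. V \<omega> = total_est j \<omega>"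
proof -
  have form: "\<exists>g \<in> borel_measurable borel. total_est j = (\<lambda>\<omega>. g (total \<omega>))"
    by (rule bexI[of _ "\<lambda>x. m $ j + slope j * (x - (\<Sum>i\<in>UNIV. m $ i))"]) (simp_all add: total_est_def)
  show "is_mmse_estimate M (\<lambda>\<omega>. L \<omega> $ j) total (total_est j)"
    unfolding is_mmse_estimate_def
    using component_L2 total_L2 total_est_L2 form total_est_best(1) by (simp add: square_integrable_real)
  assume V: "is_mmse_estimate M (\<lambda>\<omega>. L \<omega> $ j) total V"
  then obtain h where h: "h \<in> borel_measurable borel" "V = (\<lambda>\<omega>. h (total \<omega>))"
    by (auto simp: is_mmse_estimate_def)
  obtain g where g: "g \<in> borel_measurable borel" "total_est j = (\<lambda>\<omega>. g (total \<omega>))" using form by blast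
  have "mse M (\<lambda>\<omega>. L \<omega> $ j) V \<le> mse M (\<lambda>\<omega>. L \<omega> $ j) (total_est j)"
    using V g total_est_L2[of j] by (auto simp: is_mmse_estimate_def)
  then show "AE \<omega> in M. V \<omega> = total_est j \<omega>"
    using total_est_best(2)[OF h(1)] V h(2) by (simp add: is_mmse_estimate_def)
qed

lemma total_est_cond_exp:
  "AE \<omega> in M. real_cond_exp M (generated_algebra M total) (\<lambda>\<omega>. L \<omega> $ j) \<omega> = total_est j \<omega>"
proof -
  have T: "total \<in> borel_measurable M" using total_L2 by (simp add: square_integrable_real)
  interpret S: finite_measure_subalgebra M "generated_algebra M total" by (rule subalgebra_generated[OF T])
  have i: "integrable M (total_est j)" "integrable M (total_err j)"
    using square_integrable_integrable total_est_L2 total_err_moments(1) by auto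
  have m: "total_est j \<in> borel_measurable (generated_algebra M total)"
    unfolding total_est_def by (rule measurable_generated) simp
  have eq: "(\<lambda>\<omega>. L \<omega> $ j) = (\<lambda>\<omega>. total_est j \<omega> + total_err j \<omega>)"
    by (simp add: total_est_error[symmetric])
  show ?thesis
    unfolding eq using S.real_cond_exp_add[OF i] S.real_cond_exp_F_meas[OF i(1) m] total_cond_exp_total_err[of j]
    by eventually_elim simp
qed

text \<open>Constants, \<open>aggregate\<close> and the innovation span the same space as constants and the two
measurements; the error is orthogonal to the former.\<close>

lemma pair_est_lmmse:
  fixes j
  defines "Y \<equiv> \<lambda>\<omega>. (total \<omega>, L \<omega> $ j + W j \<omega>)"
  shows "is_lmmse_estimate M (\<lambda>\<omega>. L \<omega> $ j) Y (pair_est j)"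
    and "is_lmmse_estimate M (\<lambda>\<omega>. L \<omega> $ j) Y V \<Longrightarrow> AE \<omega> in M. V \<omega> = pair_est j \<omega>"
proof -
  let ?X = "\<lambda>\<omega>. L \<omega> $ j"
  define \<mu> where "\<mu> = (\<Sum>i\<in>UNIV. m $ i)"
  have YL2: "square_integrable M Y"
    unfolding Y_def
    by (intro square_integrable_Pair square_integrable_add total_L2 component_L2 noise_L2)
  have affine_L2: "square_integrable M (\<lambda>\<omega>. a + c \<bullet> Y \<omega>)" for a c
  proof -
    have "(\<lambda>\<omega>. a + c \<bullet> Y \<omega>) = (\<lambda>\<omega>. a + (fst c * total \<omega> + snd c * (L \<omega> $ j + W j \<omega>)))"
      by (simp add: Y_def inner_prod_def)
    then show ?thesis
      by (simp only:) (intro square_integrable_add square_integrable_const square_integrable_scale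
          total_L2 component_L2 noise_L2)
  qed
  have form: "pair_est j = (\<lambda>\<omega>. (m $ j - (1 - gain j) * slope j * \<mu> - gain j * m $ j)
      + ((1 - gain j) * slope j, gain j) \<bullet> Y \<omega>)"
    by (simp add: pair_est_def total_est_def Y_def \<mu>_def[symmetric] fun_eq_iff algebra_simps)
  have orth: "expectation (\<lambda>\<omega>. (L \<omega> $ j - pair_est j \<omega>) * (pair_est j \<omega> - (a + c \<bullet> Y \<omega>))) = 0" for a c
  proof -
    have "pair_est j \<omega> - (a + c \<bullet> Y \<omega>) = (m $ j - a - fst c * \<mu> - snd c * m $ j)
       + (slope j - fst c - snd c * slope j) * aggregate \<omega> + (gain j - snd c) * (total_err j \<omega> + W j \<omega>)" for \<omega>
      by (simp add: pair_est_def total_est_def Y_def inner_prod_def total_eq component_eq total_err_def \<mu>_def[symmetric] algebra_simps)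
    then show ?thesis unfolding pair_est_error by (simp only: pair_err_orthogonal)
  qed
  have pair_est_L2: "square_integrable M (pair_est j)" unfolding form by (rule affine_L2)
  note best = orthogonal_error_best[OF component_L2 pair_est_L2 affine_L2 orth]
  show "is_lmmse_estimate M ?X Y (pair_est j)"
    unfolding is_lmmse_estimate_def using component_L2 YL2 form best(1) by blast
  assume V: "is_lmmse_estimate M ?X Y V"
  then obtain a c where ac: "V = (\<lambda>\<omega>. a + c \<bullet> Y \<omega>)" by (auto simp: is_lmmse_estimate_def)
  have "mse M ?X V \<le> mse M ?X (pair_est j)"
    using V unfolding is_lmmse_estimate_def form by blast
  then show "AE \<omega> in M. V \<omega> = pair_est j \<omega>" unfolding ac by (rule best(2))
qed

end

section \<open>The estimate of a component from the sum and its own measurement\<close>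

theorem proposition4:
  fixes M :: "'a measure"
    and L :: "'a \<Rightarrow> real ^ 'n" and W0 :: "'a \<Rightarrow> real" and W :: "'n \<Rightarrow> 'a \<Rightarrow> real"
    and Z0 :: "'a \<Rightarrow> real" and Z :: "'n \<Rightarrow> 'a \<Rightarrow> real"
    and m :: "real ^ 'n" and P :: "real ^ 'n ^ 'n"
    and \<sigma>0 R0 :: real and b R :: "'n \<Rightarrow> real"
    and m0 P0 :: real and Prow K Q0 Q0j :: "'n \<Rightarrow> real"
    and Lh0 Lh0j :: "'n \<Rightarrow> 'a \<Rightarrow> real"
  assumes "prob_space M"
    and "covariance_matrix P"
    and "R0 = \<sigma>0\<^sup>2" and "R0 > 0"
    and "\<And>i. b i > 0" and "\<And>i. R i = 2 * (b i)\<^sup>2"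
    and "gaussian_vector M L m P"
    and "normal_rv M W0 0 R0"
    and "\<And>i. laplace_rv M (W i) (b i)"
    and "mutually_indep M L W0 W"
    and "Z0 = (\<lambda>\<omega>. (\<Sum>i\<in>UNIV. L \<omega> $ i) + W0 \<omega>)"
    and "\<And>i. Z i = (\<lambda>\<omega>. L \<omega> $ i + W i \<omega>)"
    and "m0 = (\<Sum>i\<in>UNIV. m $ i)"
    and "P0 = (\<chi> i. 1) \<bullet> (P *v (\<chi> i. 1))"
    and "\<And>j. Prow j = (\<Sum>k\<in>UNIV. P $ j $ k)"
    and "\<And>j. Lh0 j = (\<lambda>\<omega>. m $ j + Prow j / (P0 + R0) * (Z0 \<omega> - m0))"
    and "\<And>j. K j = ((R0 + P0) * P $ j $ j - (Prow j)\<^sup>2) /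
                     ((R0 + P0) * (P $ j $ j + R j) - (Prow j)\<^sup>2)"
    and "\<And>j. Lh0j j = (\<lambda>\<omega>. Lh0 j \<omega> +
                     K j * ((Z j \<omega> - m $ j) - Prow j / (R0 + P0) * (Z0 \<omega> - m0)))"
    and "\<And>j. Q0 j = prob_space.expectation M (\<lambda>\<omega>. (Lh0 j \<omega> - L \<omega> $ j)\<^sup>2)"
    and "\<And>j. Q0j j = prob_space.expectation M (\<lambda>\<omega>. (L \<omega> $ j - Lh0j j \<omega>)\<^sup>2)"
  shows "\<forall>j.
      is_lmmse_estimate M (\<lambda>\<omega>. L \<omega> $ j) (\<lambda>\<omega>. (Z0 \<omega>, Z j \<omega>)) (Lh0j j) \<and>
      (\<forall>V. is_lmmse_estimate M (\<lambda>\<omega>. L \<omega> $ j) (\<lambda>\<omega>. (Z0 \<omega>, Z j \<omega>)) V \<longrightarrow>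
             (AE \<omega> in M. V \<omega> = Lh0j j \<omega>)) \<and>
      is_mmse_estimate M (\<lambda>\<omega>. L \<omega> $ j) Z0 (Lh0 j) \<and>
      (\<forall>V. is_mmse_estimate M (\<lambda>\<omega>. L \<omega> $ j) Z0 V \<longrightarrow> (AE \<omega> in M. V \<omega> = Lh0 j \<omega>)) \<and>
      (AE \<omega> in M. real_cond_exp M (generated_algebra M Z0) (\<lambda>\<omega>. L \<omega> $ j) \<omega> = Lh0 j \<omega>) \<and>
      K j \<in> {0..1} \<and>
      Q0j j = Q0 j * (1 - K j) \<and>
      Q0j j \<le> Q0 j \<and>
      Q0 j = P $ j $ j - (Prow j)\<^sup>2 / (P0 + R0)"
proof -
  interpret model: linear_measurement_model M L W0 W m P R0 b
    by (rule linear_measurement_model.intro[OF assms(1)], unfold_locales) (use assms in auto)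
  have R: "R j = 2 * (b j)\<^sup>2" for j using assms(6) .
  have row: "Prow j = axis j 1 \<bullet> (P *v (\<chi> i. 1))" for j
    by (simp add: assms(15) inner_axis' matrix_vector_mult_def)
  have diag: "P $ j $ j = axis j 1 \<bullet> (P *v axis j 1)" for j
    by (simp add: inner_axis' matrix_vector_mul_component inner_axis)
  have slope: "Prow j / (P0 + R0) = model.slope j" for j
    by (simp add: model.slope_def row assms(14))
  have K: "K j = model.gain j" for j
    unfolding assms(17) model.gain_eq R row diag assms(14) ..
  have Z0: "Z0 = model.total" by (simp add: assms(11) model.total_def)
  have Z: "Z j = (\<lambda>\<omega>. L \<omega> $ j + W j \<omega>)" for j by (rule assms(12))
  have Lh0: "Lh0 j = model.total_est j" for j
    by (simp add: assms(16) model.total_est_def slope Z0 assms(13))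
  have Lh0j: "Lh0j j = model.pair_est j" for j
    by (simp add: assms(18) model.pair_est_def Lh0 K Z slope add.commute[of R0] Z0 assms(13))
  have Q0: "Q0 j = model.total_mse j" for j
    unfolding assms(19) Lh0 power2_commute[of "model.total_est j _"] model.total_est_error
    by (rule model.total_err_moments(3))
  have Q0j: "Q0j j = model.total_mse j * (1 - model.gain j)" for j
    unfolding assms(20) Lh0j model.pair_est_error by (rule model.pair_err_mean_square)
  have Q0_eq: "Q0 j = P $ j $ j - (Prow j)\<^sup>2 / (P0 + R0)" for j
    by (simp only: Q0 model.total_mse_def row diag assms(14))
  have Q0j_le: "Q0j j \<le> Q0 j" for j
    unfolding Q0 Q0j using model.total_mse_nonneg model.gain_bounds by (intro mult_left_le) auto
  show ?thesis
    unfolding Lh0 Lh0j K Z0 Z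
    using model.pair_est_lmmse model.total_est_mmse model.total_est_cond_exp model.gain_bounds
      Q0 Q0j Q0j_le Q0_eq by auto
qed

end
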